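(* Let $(r_n)_{n\ge 0}$ be a base-$3/2$ reverse sorted Fibs sequence whose two starting terms $r_0,r_1$ are reverse sorted and not both zero. Then the sequence always ends in a cycle or the tail of the Oihcconip sequence. That is, at least one of the following holds: (i) there exist $k>1$ and $N\ge 0$ such that $r_{N+3i}=r_{N+3i+1}=2_k1$ and $r_{N+3i+2}=2_k1_2$ for all $i\ge 0$; (ii) there exist $k>1$ and $N\ge 0$ such that $r_{N+2i}=r_{N+2i+1}=2_{k+i}1_2$ for all $i\ge 0$.
   Context: Numbers are written as finite strings of digits $0,1,2$ in base $3/2$ (strings need not represent integers). The notation $\delta_k$ denotes $k$ copies of the digit $\delta$ in a row (index $1$ is omitted), so $2_k1_2$ is the string of $k$ twos followed by two ones. Addition in base $3/2$: right-align the two strings, add digitwise, then carry: as long as some digit is at least $3$, subtract $3$ from it and add $2$ to the digit immediately to its left, until all digits are in $\{0,1,2\}$. The result does not depend on the order of the carries. A string is reverse sorted if it consists of some number (possibly none) of $2$s followed by some number (possibly none) of $1$s, with no zeros; the number $0$ corresponds to the string with no nonzero digits. A (base-$3/2$) reverse sorted Fibs sequence $(r_n)_{n\ge0}$ is defined by two starting terms $r_0,r_1$ and, for $n\ge1$, $r_{n+1}$ is obtained by adding $r_{n-1}$ and $r_n$ in base $3/2$, discarding all zeros, and sorting the remaining digits in decreasing order. The cycles referred to are the 3-cycles $2_k1,\ 2_k1,\ 2_k1_2$ with $k>1$. The Oihcconip sequence is the indefinitely growing reverse sorted Fibs sequence $2_k1_2,\ 2_k1_2,\ 2_{k+1}1_2,\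 2_{k+1}1_2,\ 2_{k+2}1_2,\ 2_{k+2}1_2,\ldots$, where $k>1$. *)

theory Defs
  imports Main
begin

text \<open>Digit strings are lists of naturals written as on paper, most significant digit first.
  Entries above 2 occur only in intermediate results, before carrying is finished.\<close>

definition pad_left :: "nat \<Rightarrow> nat list \<Rightarrow> nat list" where
  "pad_left n xs = replicate (n - length xs) 0 @ xs"

definition digitwise_sum :: "nat list \<Rightarrow> nat list \<Rightarrow> nat list" where
  "digitwise_sum xs ys = map2 (+) (pad_left (length ys) xs) (pad_left (length xs) ys)"

text \<open>The rule \<open>leading\<close> is the carry out of the leftmost digit, where the digit to the
  left is an implicit 0.\<close>

inductive carry :: "nat list \<Rightarrow> nat list \<Rightarrow> bool" where
  leading: "d \<ge> 3 \<Longrightarrow> carry (d # ys) (2 # (d - 3) # ys)"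
| inner: "d \<ge> 3 \<Longrightarrow> carry (xs @ e # d # ys) (xs @ (e + 2) # (d - 3) # ys)"

definition carried :: "nat list \<Rightarrow> nat list \<Rightarrow> bool" where
  "carried xs zs \<longleftrightarrow> carry\<^sup>*\<^sup>* xs zs \<and> (\<forall>d \<in> set zs. d \<le> 2)"

text \<open>The description below is proper: \<open>carried_ex1\<close> shows that carrying terminates in
  exactly one string, whatever the order of the carries.\<close>

definition add32 :: "nat list \<Rightarrow> nat list \<Rightarrow> nat list" where
  "add32 xs ys = (THE zs. carried (digitwise_sum xs ys) zs)"

definition reverse_sort :: "nat list \<Rightarrow> nat list" where
  "reverse_sort xs = rev (sort (filter (\<lambda>d. d \<noteq> 0) xs))"

definition twos_ones :: "nat \<Rightarrow> nat \<Rightarrow> nat list" where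
  "twos_ones k m = replicate k 2 @ replicate m 1"

text \<open>The only reverse sorted string representing the number 0 is \<open>twos_ones 0 0 = []\<close>.\<close>

definition reverse_sorted :: "nat list \<Rightarrow> bool" where
  "reverse_sorted xs \<longleftrightarrow> (\<exists>k m. xs = twos_ones k m)"

definition reverse_sorted_Fibs :: "(nat \<Rightarrow> nat list) \<Rightarrow> bool" where
  "reverse_sorted_Fibs r \<longleftrightarrow> (\<forall>n\<ge>1. r (n + 1) = reverse_sort (add32 (r (n - 1)) (r n)))"


text \<open>Carrying from right to left. The list is in reverse order, least significant digit first,
  and \<open>c\<close> is the incoming carry.\<close>

function ripple :: "nat \<Rightarrow> nat list \<Rightarrow> nat list" where
  "ripple c [] = (if c = 0 then [] else c mod 3 # ripple (2 * (c div 3)) [])"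
| "ripple c (d # ds) = (c + d) mod 3 # ripple (2 * ((c + d) div 3)) ds"
  by pat_completeness auto
termination
  by (relation "measures [\<lambda>(c, ds). length ds, fst]") auto

declare ripple.simps [simp del]

lemma ripple_digits: "\<forall>d \<in> set (ripple c ds). d \<le> 2"
proof (induction c ds rule: ripple.induct)
  case (1 c)
  then show ?case
    by (cases "c = 0") (simp_all add: ripple.simps(1)[of c] ripple.simps(1)[of 0])
next
  case (2 c d ds)
  then show ?case
    by (simp add: ripple.simps(2))
qed

lemma ripple_fixed: "\<forall>d \<in> set ds. d \<le> 2 \<Longrightarrow> ripple 0 ds = ds"
  by (induction ds) (auto simp: ripple.simps)

lemma ripple_pair:
  assumes "d \<ge> 3"
  shows "ripple c (d # e # ds) = ripple c ((d - 3) # (e + 2) # ds)"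
proof -
  obtain d' where d: "d = d' + 3"
    using assms by (metis le_add_diff_inverse2)
  have "(c + d) mod 3 = (c + d') mod 3" "(c + d) div 3 = (c + d') div 3 + 1"
    using d by presburger+
  with d show ?thesis
    by (simp add: ripple.simps(2) algebra_simps)
qed

lemma ripple_single:
  assumes "d \<ge> 3"
  shows "ripple c [d] = ripple c [d - 3, 2]"
proof -
  have "ripple c [d] = ripple c [d, 0]"
  proof -
    have "2 * ((c + d) div 3) \<noteq> 0"
      using assms by simp
    then show ?thesis
      by (simp add: ripple.simps(2)) (subst ripple.simps(1), simp)
  qed
  then show ?thesis
    using ripple_pair[OF assms, of c 0 "[]"] by (simp only: add_0)
qed

lemma ripple_append:
  assumes "\<And>c. ripple c ds = ripple c es"
  shows "ripple c (bs @ ds) = ripple c (bs @ es)"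
  using assms by (induction bs arbitrary: c) (simp_all add: ripple.simps(2))

lemma carry_ripple:
  assumes "carry xs zs"
  shows "ripple 0 (rev xs) = ripple 0 (rev zs)"
  using assms
proof cases
  case (leading d ys)
  then show ?thesis
    using ripple_append[OF ripple_single, of d 0 "rev ys"] by simp
next
  case (inner d xs e ys)
  then show ?thesis
    using ripple_append[OF ripple_pair, of d 0 "rev ys" e "rev xs"] by simp
qed

lemma carries_ripple: "carry\<^sup>*\<^sup>* xs zs \<Longrightarrow> ripple 0 (rev xs) = ripple 0 (rev zs)"
  by (induction rule: rtranclp_induct) (auto dest: carry_ripple)

lemma carry_append:
  assumes "carry xs zs"
  shows "carry (xs @ ws) (zs @ ws)"
  using assms
proof cases
  case (leading d ys)
  then show ?thesis
    using carry.leading[of d "ys @ ws"] by simp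
next
  case (inner d us e ys)
  then show ?thesis
    using carry.inner[of d us e "ys @ ws"] by simp
qed

lemma carries_append: "carry\<^sup>*\<^sup>* xs zs \<Longrightarrow> carry\<^sup>*\<^sup>* (xs @ ws) (zs @ ws)"
  by (induction rule: rtranclp_induct) (auto intro: carry_append rtranclp.rtrancl_into_rtrancl)

lemma carries_inner: "carry\<^sup>*\<^sup>* (xs @ [e, 3 * q + d]) (xs @ [e + 2 * q, d])"
proof (induction q arbitrary: e)
  case 0
  then show ?case by simp
next
  case (Suc q)
  have "carry (xs @ [e, 3 * Suc q + d]) (xs @ [e + 2, 3 * q + d])"
    using carry.inner[of "3 * Suc q + d" xs e "[]"] by simp
  with Suc[of "e + 2"] show ?case
    by (simp add: converse_rtranclp_into_rtranclp algebra_simps)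
qed

lemma carries_leading:
  assumes "q > 0"
  shows "carry\<^sup>*\<^sup>* [3 * q + d] [2 * q, d]"
proof -
  obtain p where q: "q = Suc p"
    using assms gr0_implies_Suc by blast
  have "carry [3 * q + d] [2, 3 * p + d]"
    using carry.leading[of "3 * q + d" "[]"] q by simp
  with carries_inner[of "[]" 2 p d] q show ?thesis
    by (simp add: converse_rtranclp_into_rtranclp)
qed

lemma carries_to_ripple_single: "n > 0 \<Longrightarrow> carry\<^sup>*\<^sup>* [n] (rev (ripple n []))"
proof (induction n rule: less_induct)
  case (less n)
  show ?case
  proof (cases "n div 3 = 0")
    case True
    with less.prems show ?thesis
      by (simp add: ripple.simps(1)[of n] ripple.simps(1)[of 0])
  next
    case False
    have "carry\<^sup>*\<^sup>* [n] [2 * (n div 3), n mod 3]"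
      using carries_leading[of "n div 3" "n mod 3"] False by simp
    moreover have "carry\<^sup>*\<^sup>* [2 * (n div 3)] (rev (ripple (2 * (n div 3)) []))"
      using less.IH[of "2 * (n div 3)"] False by simp
    from carries_append[OF this, of "[n mod 3]"]
    have "carry\<^sup>*\<^sup>* [2 * (n div 3), n mod 3] (rev (ripple n []))"
      using less.prems by (simp add: ripple.simps(1)[of n])
    ultimately show ?thesis
      by (rule rtranclp_trans)
  qed
qed

lemma carries_to_ripple: "carry\<^sup>*\<^sup>* (rev (d # ds)) (rev (ripple 0 (d # ds)))"
proof (induction ds arbitrary: d)
  case Nil
  show ?case
  proof (cases "d = 0")
    case True
    then show ?thesis by (simp add: ripple.simps)
  next
    case False
    then have "ripple 0 [d] = ripple d []"
      by (simp add: ripple.simps(1)[of d] ripple.simps(2))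
    with False show ?thesis
      using carries_to_ripple_single[of d] by simp
  qed
next
  case (Cons e ds)
  let ?e = "e + 2 * (d div 3)"
  have "carry\<^sup>*\<^sup>* (rev (d # e # ds)) (rev (d mod 3 # ?e # ds))"
    using carries_inner[of "rev ds" e "d div 3" "d mod 3"] by simp
  moreover have "carry\<^sup>*\<^sup>* (rev (d mod 3 # ?e # ds)) (rev (ripple 0 (d # e # ds)))"
    using carries_append[OF Cons[of ?e], of "[d mod 3]"]
    by (simp add: ripple.simps(2) algebra_simps)
  ultimately show ?case
    by (rule rtranclp_trans)
qed

lemma carried_iff: "carried xs zs \<longleftrightarrow> zs = rev (ripple 0 (rev xs))"
proof
  assume "carried xs zs"
  then have "ripple 0 (rev xs) = rev zs"
    using carries_ripple[of xs zs] ripple_fixed[of "rev zs"] by (simp add: carried_def)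
  then show "zs = rev (ripple 0 (rev xs))" by simp
next
  have "carry\<^sup>*\<^sup>* xs (rev (ripple 0 (rev xs)))"
  proof (cases xs rule: rev_cases)
    case Nil
    then show ?thesis by (simp add: ripple.simps)
  next
    case (snoc ys d)
    then show ?thesis using carries_to_ripple[of d "rev ys"] by simp
  qed
  moreover assume "zs = rev (ripple 0 (rev xs))"
  ultimately show "carried xs zs"
    using ripple_digits by (auto simp: carried_def)
qed

lemma carried_ex1: "\<exists>!zs. carried xs zs"
  by (simp add: carried_iff)

lemma add32_eq_ripple: "add32 xs ys = rev (ripple 0 (rev (digitwise_sum xs ys)))"
  by (simp add: add32_def carried_iff)

end

theory Submission
  imports Defs "HOL-Library.Multiset"
begin

text \<open>
  A reverse sorted string is determined by how many twos and how many ones it has, so the sequence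
  is a recurrence on pairs \<open>(twos, ones)\<close>. Right-align two such strings, the first with no more
  ones than the second: the columns sum, from right to left, to a block of 2s (one over one), a
  block of 3s (two over one), a block of 4s (two over two), and then the digits of whichever string sticks
  out. Within a block the carry is stationary after at most two columns, and from there on the block
  yields equal digits. Long runs of 1s come only from single ones that no carry reaches, or from a
  carry 2 that passes through single twos. This gives the piecewise linear formula \<open>ordered_sum\<close>
  for a sum (\<open>reverse_sort_add32_twos_ones\<close>), and everything after that is arithmetic of pairs.

  Degenerate terms disappear by themselves. A sum of nonzero terms has a two; a sum of terms with a
  two has both a two and a one; a sum of terms with a two and a one has at least two twos. Each
  of these properties contains the preceding one, so each is reached two steps after it
  (\<open>eventually_full\<close>).

  For terms with at least two twos and a one, the sum has one or two ones unless one of the two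
  strings lies entirely below the ones of the other. That exceptional position cannot persist
  (\<open>eventually_not_apart\<close>), and once it has been left it never returns, because a sum of two
  strings in ordinary position is too long to lie below the ones of the second summand and has too
  few ones to cover it (\<open>sum_counts_not_apart\<close>). Hence eventually all terms have one or two ones.

  Then the numbers of ones follow the Fibonacci rule modulo 2. If two consecutive terms both have
  two ones, all later terms do, and the numbers of twos settle into the Oihcconip pattern.
  Otherwise two consecutive terms with a single one occur, and three steps later the
  sequence is periodic.
\<close>

section \<open>Adding two reverse sorted strings\<close>

lemma reverse_sort_rev:
  assumes "\<forall>d \<in> set ds. d \<le> 2"
  shows "reverse_sort (rev ds) = twos_ones (count_list ds 2) (count_list ds 1)"
proof -
  have "sort (filter (\<lambda>d. d \<noteq> 0) (rev ds)) = replicate (count_list ds 1) 1 @ replicate (count_list ds 2) 2"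
  proof (rule properties_for_sort)
    show "mset (replicate (count_list ds 1) 1 @ replicate (count_list ds 2) 2)
        = mset (filter (\<lambda>d. d \<noteq> 0) (rev ds))"
    proof (rule multiset_eqI)
      fix v :: nat
      have "v = 0 \<or> v = 1 \<or> v = 2 \<or> v \<notin> set ds"
        using assms by fastforce
      then show "count (mset (replicate (count_list ds 1) 1 @ replicate (count_list ds 2) 2)) v
        = count (mset (filter (\<lambda>d. d \<noteq> 0) (rev ds))) v"
        by (auto simp: count_mset)
    qed
  qed (simp add: sorted_append)
  then show ?thesis
    by (simp add: reverse_sort_def twos_ones_def)
qed

lemma reverse_sort_add32:
  assumes "rev (digitwise_sum xs ys) = ds"
  shows "reverse_sort (add32 xs ys) =
    twos_ones (count_list (ripple 0 ds) 2) (count_list (ripple 0 ds) 1)"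
  using assms by (simp add: add32_eq_ripple reverse_sort_rev ripple_digits)

lemma add32_commute: "add32 xs ys = add32 ys xs"
proof -
  have "digitwise_sum xs ys = digitwise_sum ys xs"
    unfolding digitwise_sum_def
    by (subst zip_commute) (simp add: case_prod_unfold add.commute)
  then show ?thesis
    by (simp add: add32_def)
qed

text \<open>
  The next three lemmas give the columns of \<open>2\<^sub>a1\<^sub>b + 2\<^sub>c1\<^sub>d\<close> with \<open>b \<le> d\<close>, least significant first,
  in three configurations: the first string ends among the ones of the second, it covers the
  second, or it ends among the twos of the second.
\<close>

lemma columns_short:
  assumes "d = b + a + q"
  shows "rev (digitwise_sum (twos_ones a b) (twos_ones c d)) =
    replicate b 2 @ replicate a 3 @ replicate q 1 @ replicate c 2"
proof -
  have "replicate d 1 = replicate q 1 @ replicate a 1 @ replicate b (1::nat)"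
    by (simp add: assms flip: replicate_add)
  moreover have "replicate (c + d - (a + b)) 0 = replicate c 0 @ replicate q (0::nat)"
    by (simp add: assms flip: replicate_add)
  ultimately show ?thesis
    by (simp add: digitwise_sum_def pad_left_def twos_ones_def assms)
qed

lemma columns_longer:
  "rev (digitwise_sum (twos_ones (g + c + e) b) (twos_ones c (e + b))) =
    replicate b 2 @ replicate e 3 @ replicate c 4 @ replicate g 2"
  by (simp add: digitwise_sum_def pad_left_def twos_ones_def replicate_add)

lemma columns_overlap:
  "rev (digitwise_sum (twos_ones (f + e) b) (twos_ones (g + f) (e + b))) =
    replicate b 2 @ replicate e 3 @ replicate f 4 @ replicate g 2"
  by (simp add: digitwise_sum_def pad_left_def twos_ones_def replicate_add)

text \<open>
  The assumption says that column sum \<open>d\<close> with carry \<open>c\<close> produces the carry \<open>c\<close> again, so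
  the carry passes through a block of equal columns unchanged.
\<close>

lemma ripple_block:
  assumes "2 * ((c + d) div 3) = c"
  shows "ripple c (replicate n d @ ds) = replicate n ((c + d) mod 3) @ ripple c ds"
  using assms by (induction n) (simp_all add: ripple.simps(2))

lemma ripple_blocks:
  "ripple 0 (replicate n 1 @ ds) = replicate n 1 @ ripple 0 ds"
  "ripple 0 (replicate n 2 @ ds) = replicate n 2 @ ripple 0 ds"
  "ripple 2 (replicate n 1 @ ds) = replicate n 0 @ ripple 2 ds"
  "ripple 2 (replicate n 2 @ ds) = replicate n 1 @ ripple 2 ds"
  "ripple 2 (replicate n 3 @ ds) = replicate n 2 @ ripple 2 ds"
  "ripple 4 (replicate n 2 @ ds) = replicate n 0 @ ripple 4 ds"
  "ripple 4 (replicate n 4 @ ds) = replicate n 2 @ ripple 4 ds"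
  by (simp_all add: ripple_block)

text \<open>
  The carry changes only in the first column of a block of 3s, in the first one or two columns of a
  block of 4s, and beyond the last column.
\<close>

lemma ripple_entering:
  "ripple 0 (3 # ds) = 0 # ripple 2 ds"
  "ripple 0 (4 # ds) = 1 # ripple 2 ds"
  "ripple 2 (4 # ds) = 0 # ripple 4 ds"
  "ripple 0 [] = []" "ripple 2 [] = [2]" "ripple 4 [] = [1, 2]"
  by (simp_all add: ripple.simps)

lemma count_list_replicate: "count_list (replicate n x) y = (if x = y then n else 0)"
  by (induction n) auto

lemmas carrying = ripple_blocks[unfolded One_nat_def] ripple_blocks[where ds = "[]", simplified]
  ripple_entering count_list_replicate

text \<open>
  The pair (twos, ones) of the sum of \<open>2\<^sub>a1\<^sub>b\<close> and \<open>2\<^sub>c1\<^sub>d\<close> when \<open>b \<le> d\<close>. The cases distinguish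
  which blocks of columns are present, since it is the change of block that alters the carry. Without
  3s the first 4 leaves a digit 1; a carry that has risen to 4 leaves a digit 1 at the very end; and a
  carry that stays at 2 turns the remaining single twos into ones.
\<close>

fun ordered_sum :: "nat \<times> nat \<Rightarrow> nat \<times> nat \<Rightarrow> nat \<times> nat" where
  "ordered_sum (a, b) (c, d) =
    (if b = d then
       (if min a c = 0 then (b + max a c, 0)
        else if min a c = 1 then (b + 1, max a c)
        else (b + min a c - 1, 2))
     else if d < a + b then
       (if c = 0 then (d, a + b - d) else (d + min (a + b - d) c - 1, 1))
     else if a = 0 then (b + c, d - b)
     else (a + b, c))"

definition sum_counts :: "nat \<times> nat \<Rightarrow> nat \<times> nat \<Rightarrow> nat \<times> nat" where
  "sum_counts x y = (if snd x \<le> snd y then ordered_sum x y else ordered_sum y x)"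

lemma reverse_sort_add32_ordered:
  assumes "b \<le> d"
  shows "reverse_sort (add32 (twos_ones a b) (twos_ones c d)) =
    case_prod twos_ones (ordered_sum (a, b) (c, d))"
proof -
  obtain e where d: "d = e + b"
    using assms by (metis add.commute le_Suc_ex)
  consider (short) q where "e = a + q" "0 < q"
    | (longer) g where "a = g + c + e"
    | (overlap) f g where "a = f + e" "c = g + f" "0 < g"
    by (metis add.assoc add.commute less_imp_add_positive linorder_neqE_nat le_Suc_ex less_or_eq_imp_le)
  then show ?thesis
  proof cases
    case (short q)
    then have "d = b + a + q" using d by simp
    from reverse_sort_add32[OF columns_short[OF this]] short d show ?thesis
      by (cases a) (auto simp: carrying intro!: arg_cong2[where f = twos_ones])
  next
    case (longer g)
    with d reverse_sort_add32[OF columns_longer[of g c e b]] show ?thesis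
      \<comment> \<open>The carry distinguishes no 3s from some 3s, and zero, one or several 4s.\<close>
      by (cases e; cases c; cases "c - 1") (auto simp: carrying intro!: arg_cong2[where f = twos_ones])
  next
    case (overlap f g)
    with d reverse_sort_add32[OF columns_overlap[of f e b g]] show ?thesis
      by (cases e; cases f; cases "f - 1") (auto simp: carrying intro!: arg_cong2[where f = twos_ones])
  qed
qed

lemma reverse_sort_add32_twos_ones:
  "reverse_sort (add32 (case_prod twos_ones x) (case_prod twos_ones y)) =
    case_prod twos_ones (sum_counts x y)"
  using reverse_sort_add32_ordered[of "snd x" "snd y" "fst x" "fst y"]
    reverse_sort_add32_ordered[of "snd y" "snd x" "fst y" "fst x"]
  by (auto simp: sum_counts_def case_prod_unfold add32_commute)

lemma sum_counts_commute: "sum_counts x y = sum_counts y x"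
  by (cases x; cases y) (auto simp: sum_counts_def min.commute max.commute)

text \<open>The reverse sorted Fibs recurrence on pairs, shifted so that no predecessor is needed.\<close>

definition fibs_counts :: "(nat \<Rightarrow> nat \<times> nat) \<Rightarrow> bool" where
  "fibs_counts s \<longleftrightarrow> (\<forall>n. s (n + 2) = sum_counts (s n) (s (n + 1)))"

section \<open>Reaching at least two twos and a one\<close>

lemma sum_counts_nonzero:
  assumes "x \<noteq> (0, 0)" "y \<noteq> (0, 0)"
  shows "1 \<le> fst (sum_counts x y)"
proof -
  have "1 \<le> fst (ordered_sum (a, b) (c, d))" if "b \<le> d" "0 < a + b" "0 < c + d" for a b c d
    using that by (simp, arith)
  with assms show ?thesis
    by (cases x; cases y) (auto simp: sum_counts_def simp del: ordered_sum.simps)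
qed

lemma sum_counts_has_one:
  assumes "1 \<le> fst x" "1 \<le> fst y"
  shows "1 \<le> fst (sum_counts x y) \<and> 1 \<le> snd (sum_counts x y)"
proof -
  have "1 \<le> fst (ordered_sum (a, b) (c, d)) \<and> 1 \<le> snd (ordered_sum (a, b) (c, d))"
    if "b \<le> d" "1 \<le> a" "1 \<le> c" for a b c d
    using that by (simp, arith)
  with assms show ?thesis
    by (cases x; cases y) (simp add: sum_counts_def del: ordered_sum.simps)
qed

definition full :: "nat \<times> nat \<Rightarrow> bool" where
  "full x \<longleftrightarrow> 2 \<le> fst x \<and> 1 \<le> snd x"

lemma full_sum_counts:
  assumes "1 \<le> fst x \<and> 1 \<le> snd x" "1 \<le> fst y \<and> 1 \<le> snd y"
  shows "full (sum_counts x y)"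
proof -
  have "full (ordered_sum (a, b) (c, d))" if "b \<le> d" "1 \<le> a" "1 \<le> b" "1 \<le> c" for a b c d
    using that by (simp add: full_def, arith)
  with assms show ?thesis
    by (cases x; cases y) (simp add: sum_counts_def del: ordered_sum.simps)
qed

text \<open>
  If sums improve \<open>P\<close> to \<open>Q\<close> and \<open>Q\<close> is no weaker, then \<open>P\<close> persists, and from the third term on
  every term is a sum of terms with \<open>P\<close>.
\<close>

lemma two_steps_later:
  assumes s: "fibs_counts s"
    and sum: "\<And>x y. P x \<Longrightarrow> P y \<Longrightarrow> Q (sum_counts x y)"
    and weaken: "\<And>x. Q x \<Longrightarrow> P x"
    and start: "P (s N)" "P (s (N + 1))"
  shows "\<forall>n \<ge> N + 2. Q (s n)"
proof -
  have P: "P (s (N + i)) \<and> P (s (N + i + 1))" for i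
  proof (induction i)
    case (Suc i)
    then have "P (s (N + i + 2))"
      using s sum weaken by (simp add: fibs_counts_def)
    with Suc show ?case by simp
  qed (use start in simp)
  show ?thesis
  proof (intro allI impI)
    fix n assume "N + 2 \<le> n"
    then obtain i where "n = N + i + 2"
      by (metis add.assoc add.commute le_Suc_ex)
    then show "Q (s n)"
      using P[of i] s sum by (simp add: fibs_counts_def)
  qed
qed

lemma eventually_full:
  assumes s: "fibs_counts s" and start: "\<not> (s 0 = (0, 0) \<and> s 1 = (0, 0))"
  shows "\<exists>N. \<forall>n \<ge> N. full (s n)"
proof -
  have rec: "s (n + 2) = sum_counts (s n) (s (n + 1))" for n
    using s by (simp add: fibs_counts_def)
  \<comment> \<open>A zero term is neutral, so it can only occur at the start, where it makes the sequence
    repeat the other starting term.\<close>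
  have "\<exists>N. s N \<noteq> (0, 0) \<and> s (N + 1) \<noteq> (0, 0)"
  proof (cases "s 1 = (0, 0)")
    case True
    then have "s 2 = s 0"
      using rec[of 0] by (cases "s 0") (auto simp: sum_counts_def numeral_2_eq_2)
    moreover from this True have "s 3 = s 2"
      using rec[of 1] by (cases "s 0") (auto simp: sum_counts_def numeral_2_eq_2 numeral_3_eq_3)
    ultimately show ?thesis
      using start True by (intro exI[of _ 2]) simp
  next
    case False
    moreover have "s 2 = s 1" if "s 0 = (0, 0)"
      using rec[of 0] that by (cases "s 1") (auto simp: sum_counts_def numeral_2_eq_2)
    ultimately show ?thesis
      by (metis add_0 one_add_one)
  qed
  then obtain N where N: "s N \<noteq> (0, 0)" "s (N + 1) \<noteq> (0, 0)" by blast
  have 1: "\<forall>n \<ge> N + 2. 1 \<le> fst (s n)"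
    by (rule two_steps_later[OF s, where P = "\<lambda>x. x \<noteq> (0, 0)"]) (use N sum_counts_nonzero in auto)
  have 2: "\<forall>n \<ge> N + 2 + 2. 1 \<le> fst (s n) \<and> 1 \<le> snd (s n)"
    by (rule two_steps_later[OF s, where P = "\<lambda>x. 1 \<le> fst x"]) (use 1 sum_counts_has_one in auto)
  have "\<forall>n \<ge> N + 2 + 2 + 2. full (s n)"
    by (rule two_steps_later[OF s, where P = "\<lambda>x. 1 \<le> fst x \<and> 1 \<le> snd x"])
      (use 2 full_sum_counts in \<open>auto simp: full_def\<close>)
  then show ?thesis by blast
qed

section \<open>Reaching at most two ones\<close>

text \<open>
  Right-aligned below \<open>y\<close>, the string \<open>x\<close> reaches only ones of \<open>y\<close>. The twos of \<open>y\<close> then stand alone,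
  and if \<open>x\<close> has a two, the carry it causes converts all of them to ones: this is how terms with many ones arise.
\<close>

definition under :: "nat \<times> nat \<Rightarrow> nat \<times> nat \<Rightarrow> bool" where
  "under x y \<longleftrightarrow> fst x + snd x \<le> snd y"

definition apart :: "nat \<times> nat \<Rightarrow> nat \<times> nat \<Rightarrow> bool" where
  "apart x y \<longleftrightarrow> under x y \<or> under y x"

lemma sum_counts_under:
  assumes "full x" "under x y"
  shows "sum_counts x y = (fst x + snd x, fst y)" "sum_counts y x = (fst x + snd x, fst y)"
proof -
  show "sum_counts x y = (fst x + snd x, fst y)"
    using assms by (cases x; cases y) (auto simp: sum_counts_def under_def full_def)
  then show "sum_counts y x = (fst x + snd x, fst y)"
    by (simp add: sum_counts_commute)
qed

text \<open>
  When neither string is under the other, enough twos meet for the carry to rise to 4, so a 1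
  appears only at the end and possibly where the first twos meet. The sum \<open>z\<close> then has at most two
  ones, whereas \<open>y\<close> has at least three digits; and \<open>z\<close> has more digits than \<open>y\<close> has ones. So the
  position persists.
\<close>

lemma sum_counts_not_apart:
  assumes "full x" "full y" "\<not> apart x y"
  shows "snd (sum_counts x y) \<in> {1, 2}" "\<not> apart y (sum_counts x y)"
  using assms
  by (cases x; cases y; auto simp: sum_counts_def under_def apart_def full_def min_def)+

text \<open>
  Suppose any two consecutive terms are apart. The explicit sum \<open>(|x|, twos of y)\<close> for \<open>x\<close> under \<open>y\<close>
  shows that the direction must alternate: if a term is under its successor, then the next term has its
  successor under it, and conversely. But the first of these two transitions leads to a pair that is
  not apart, so being under the successor never happens, and then the
  alternation fails.
\<close>

lemma eventually_not_apart:
  assumes s: "fibs_counts s" and full: "\<forall>n \<ge> N. full (s n)"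
  shows "\<exists>n \<ge> N. \<not> apart (s n) (s (n + 1))"
proof (rule ccontr)
  assume "\<not> ?thesis"
  then have ap: "apart (s n) (s (n + 1))" if "N \<le> n" for n
    using that by blast
  have rec: "s (n + 2) = sum_counts (s n) (s (n + 1))" for n
    using s by (simp add: fibs_counts_def)
  have not_twice_forwards: "\<not> under (s (n + 1)) (s (n + 2))"
    if "N \<le> n" "under (s n) (s (n + 1))" for n
    using sum_counts_under(1)[of "s n" "s (n + 1)"] rec[of n] full[rule_format, of n]
      full[rule_format, of "n + 1"] that
    by (simp add: under_def full_def)
  have not_twice_backwards: "\<not> under (s (n + 2)) (s (n + 1))"
    if "N \<le> n" "under (s (n + 1)) (s n)" for n
    using sum_counts_under(2)[of "s (n + 1)" "s n"] rec[of n] full[rule_format, of n]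
      full[rule_format, of "n + 1"] that
    by (simp add: under_def full_def)
  have no_forwards: "\<not> under (s n) (s (n + 1))" if "N \<le> n" for n
  proof
    assume fw: "under (s n) (s (n + 1))"
    then have bw: "under (s (n + 2)) (s (n + 1))"
      using not_twice_forwards[OF that] ap[of "n + 1"] that by (simp add: apart_def)
    have z: "s (n + 2) = (fst (s n) + snd (s n), fst (s (n + 1)))"
      using sum_counts_under(1)[of "s n" "s (n + 1)"] rec[of n] full that fw by simp
    have "s (n + 3) = (fst (s (n + 2)) + snd (s (n + 2)), fst (s (n + 1)))"
      using sum_counts_under(2)[of "s (n + 2)" "s (n + 1)"] rec[of "n + 1"] full that bw
      by (simp add: numeral_3_eq_3)
    moreover have "apart (s (n + 2)) (s (n + 3))"
      using ap[of "n + 2"] that by (simp add: eval_nat_numeral)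
    moreover have "full (s n)"
      using full that by simp
    ultimately show False
      using z by (simp add: apart_def under_def full_def)
  qed
  then have "under (s (N + 1)) (s N)" "under (s (N + 2)) (s (N + 1))"
    using ap[of N] ap[of "N + 1"] no_forwards[of N] no_forwards[of "N + 1"] by (auto simp: apart_def)
  then show False
    using not_twice_backwards[of N] by simp
qed

lemma eventually_few_ones:
  assumes s: "fibs_counts s" and full: "\<forall>n \<ge> N. full (s n)"
  shows "\<exists>M. \<forall>n \<ge> M. 2 \<le> fst (s n) \<and> snd (s n) \<in> {1, 2}"
proof -
  obtain n where n: "N \<le> n" "\<not> apart (s n) (s (n + 1))"
    using eventually_not_apart[OF assms] by blast
  have rec: "s (m + 2) = sum_counts (s m) (s (m + 1))" for m
    using s by (simp add: fibs_counts_def)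
  have ap: "\<not> apart (s (n + i)) (s (n + i + 1))" for i
  proof (induction i)
    case (Suc i)
    then show ?case
      using sum_counts_not_apart(2)[of "s (n + i)" "s (n + i + 1)"] rec[of "n + i"] full n(1)
      by simp
  qed (use n in simp)
  have "snd (s m) \<in> {1, 2}" if "n + 2 \<le> m" for m
  proof -
    obtain i where "m = n + 2 + i"
      using le_Suc_ex \<open>n + 2 \<le> m\<close> by blast
    then have "m = n + i + 2" by simp
    then show ?thesis
      using sum_counts_not_apart(1)[of "s (n + i)" "s (n + i + 1)"] rec[of "n + i"] full n(1) ap[of i]
      by simp
  qed
  with full n show ?thesis
    by (intro exI[of _ "n + 2"]) (auto simp: full_def)
qed

section \<open>The two endings\<close>

lemma sum_counts_few_ones:
  assumes "2 \<le> a" "2 \<le> c"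
  shows "sum_counts (a, 1) (c, 1) = (min a c, 2)"
    and "sum_counts (a, 1) (c, 2) = (min a (c + 1), 1)"
    and "sum_counts (a, 2) (c, 1) = (min c (a + 1), 1)"
    and "sum_counts (a, 2) (c, 2) = (min a c + 1, 2)"
  using assms by (auto simp: sum_counts_def min_def)

text \<open>
  The numbers of twos may differ at first, but the minimum in each sum equalises them: the
  fourth and fifth term both have \<open>min c (min a c + 1)\<close> twos.
\<close>

lemma ends_in_cycle:
  assumes s: "fibs_counts s" and start: "s N = (a, 1)" "s (N + 1) = (c, 1)" and ac: "2 \<le> a" "2 \<le> c"
  shows "\<exists>k>1. \<exists>N. \<forall>i. s (N + 3 * i) = (k, 1) \<and> s (N + 3 * i + 1) = (k, 1) \<and> s (N + 3 * i + 2) = (k, 2)"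
proof -
  have rec: "s (n + 2) = sum_counts (s n) (s (n + 1))" for n
    using s by (simp add: fibs_counts_def)
  define k where "k = min c (min a c + 1)"
  have k: "2 \<le> k" using ac by (auto simp: k_def)
  have 2: "s (N + 2) = (min a c, 2)"
    using rec[of N] sum_counts_few_ones start ac by simp
  have 3: "s (N + 3) = (k, 1)"
    using rec[of "N + 1"] sum_counts_few_ones(2)[of c "min a c"] start ac 2
    by (simp add: k_def numeral_3_eq_3)
  have 4: "s (N + 4) = (k, 1)"
    using rec[of "N + 2"] sum_counts_few_ones(3)[of "min a c" k] ac 2 3 k
    by (simp add: k_def eval_nat_numeral)
  have "s (N + 3 + 3 * i) = (k, 1) \<and> s (N + 3 + 3 * i + 1) = (k, 1) \<and> s (N + 3 + 3 * i + 2) = (k, 2)" for i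
  proof (induction i)
    case 0
    then show ?case
      using 3 4 rec[of "N + 3"] sum_counts_few_ones(1)[OF k k] by (simp add: eval_nat_numeral)
  next
    case (Suc i)
    let ?m = "N + 3 + 3 * i"
    have "s (?m + 3) = (k, 1)"
      using Suc rec[of "?m + 1"] sum_counts_few_ones(2)[OF k k] by (simp add: eval_nat_numeral)
    moreover from this have "s (?m + 4) = (k, 1)"
      using Suc rec[of "?m + 2"] sum_counts_few_ones(3)[OF k k] by (simp add: eval_nat_numeral)
    moreover from calculation have "s (?m + 5) = (k, 2)"
      using rec[of "?m + 3"] sum_counts_few_ones(1)[OF k k] by (simp add: eval_nat_numeral)
    ultimately show ?case
      by (simp add: eval_nat_numeral)
  qed
  then show ?thesis
    using k by (intro exI[of _ k] conjI exI[of _ "N + 3"]) auto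
qed

lemma two_twos_from:
  assumes s: "fibs_counts s" and start: "s N = (k, 2)" "s (N + 1) = (k, 2)" and k: "2 \<le> k"
  shows "s (N + 2 * i) = (k + i, 2) \<and> s (N + 2 * i + 1) = (k + i, 2)"
proof (induction i)
  case (Suc i)
  have rec: "s (n + 2) = sum_counts (s n) (s (n + 1))" for n
    using s by (simp add: fibs_counts_def)
  let ?m = "N + 2 * i"
  have "s (?m + 2) = (k + i + 1, 2)"
    using Suc rec[of ?m] sum_counts_few_ones(4)[of "k + i" "k + i"] k by simp
  moreover from this have "s (?m + 3) = (k + i + 1, 2)"
    using Suc rec[of "?m + 1"] sum_counts_few_ones(4)[of "k + i" "k + i + 1"] k
    by (simp add: numeral_3_eq_3)
  ultimately show ?case
    by (simp add: numeral_3_eq_3)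
qed (use start in simp)

text \<open>
  Two arbitrary numbers of twos differ by at most one from the third term on, after which the
  numbers of twos come in equal pairs, starting with the third or the fourth term.
\<close>

lemma ends_in_Oihcconip:
  assumes s: "fibs_counts s" and start: "s N = (a, 2)" "s (N + 1) = (c, 2)" and ac: "2 \<le> a" "2 \<le> c"
  shows "\<exists>k>1. \<exists>N. \<forall>i. s (N + 2 * i) = (k + i, 2) \<and> s (N + 2 * i + 1) = (k + i, 2)"
proof -
  have rec: "s (n + 2) = sum_counts (s n) (s (n + 1))" for n
    using s by (simp add: fibs_counts_def)
  \<comment> \<open>The twos continue \<open>a, c, m + 1, p + 1, m + 2, p + 2\<close>. Equal neighbours appear at the third
    term if \<open>p = m\<close> and at the fourth if \<open>p = m + 1\<close>.\<close>
  define m where "m = min a c"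
  define p where "p = min c (m + 1)"
  have m: "2 \<le> m" and p: "p = m \<or> p = m + 1"
    using ac by (auto simp: m_def p_def)
  have 2: "s (N + 2) = (m + 1, 2)"
    using rec[of N] sum_counts_few_ones start ac by (simp add: m_def)
  have 3: "s (N + 3) = (p + 1, 2)"
    using rec[of "N + 1"] sum_counts_few_ones(4)[of c "m + 1"] start ac 2 m
    by (simp add: p_def numeral_3_eq_3)
  from p show ?thesis
  proof
    assume "p = m"
    then show ?thesis
      using two_twos_from[OF s, of "N + 2" "m + 1"] 2 3 m
      by (intro exI[of _ "m + 1"] conjI exI[of _ "N + 2"]) (auto simp: numeral_3_eq_3)
  next
    assume "p = m + 1"
    moreover have "s (N + 4) = (m + 2, 2)"
      using rec[of "N + 2"] sum_counts_few_ones(4)[of "m + 1" "p + 1"] 2 3 m \<open>p = m + 1\<close>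
      by (simp add: eval_nat_numeral)
    ultimately show ?thesis
      using two_twos_from[OF s, of "N + 3" "m + 2"] 3 m
      by (intro exI[of _ "m + 2"] conjI exI[of _ "N + 3"]) (auto simp: eval_nat_numeral)
  qed
qed

lemma fibs_counts_ending:
  assumes s: "fibs_counts s" and start: "\<not> (s 0 = (0, 0) \<and> s 1 = (0, 0))"
  shows "(\<exists>k>1. \<exists>N. \<forall>i. s (N + 3 * i) = (k, 1) \<and> s (N + 3 * i + 1) = (k, 1) \<and> s (N + 3 * i + 2) = (k, 2)) \<or>
    (\<exists>k>1. \<exists>N. \<forall>i. s (N + 2 * i) = (k + i, 2) \<and> s (N + 2 * i + 1) = (k + i, 2))"
proof -
  obtain M where M: "\<And>n. M \<le> n \<Longrightarrow> 2 \<le> fst (s n) \<and> snd (s n) \<in> {1, 2}"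
    using eventually_few_ones[OF s] eventually_full[OF assms] by blast
  have rec: "s (n + 2) = sum_counts (s n) (s (n + 1))" for n
    using s by (simp add: fibs_counts_def)
  have one_iff: "snd (s (n + 2)) = 1 \<longleftrightarrow> snd (s n) \<noteq> snd (s (n + 1))" if "M \<le> n" for n
    using M[of n] M[of "n + 1"] that sum_counts_few_ones[of "fst (s n)" "fst (s (n + 1))"] rec[of n]
    by (cases "s n"; cases "s (n + 1)") auto
  \<comment> \<open>The parities of the numbers of ones run through odd, odd, even unless two consecutive ones are
    even.\<close>
  consider (twos) "snd (s M) = 2" "snd (s (M + 1)) = 2"
    | (ones) n where "M \<le> n" "snd (s n) = 1" "snd (s (n + 1)) = 1"
  proof -
    assume twos: "snd (s M) = 2 \<Longrightarrow> snd (s (M + 1)) = 2 \<Longrightarrow> thesis"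
      and later: "\<And>n. M \<le> n \<Longrightarrow> snd (s n) = 1 \<Longrightarrow> snd (s (n + 1)) = 1 \<Longrightarrow> thesis"
    have "snd (s M) \<in> {1, 2}" "snd (s (M + 1)) \<in> {1, 2}"
      using M[of M] M[of "M + 1"] by simp_all
    moreover have "snd (s (M + 2)) = 1 \<longleftrightarrow> snd (s M) \<noteq> snd (s (M + 1))"
      using one_iff[of M] by simp
    moreover have "snd (s (M + 3)) = 1 \<longleftrightarrow> snd (s (M + 1)) \<noteq> snd (s (M + 2))"
      using one_iff[of "M + 1"] by (simp add: numeral_3_eq_3)
    moreover have "snd (s (M + 1)) = 1 \<Longrightarrow> snd (s (M + 2)) = 1 \<Longrightarrow> thesis"
      using later[of "M + 1"] by simp
    moreover have "snd (s (M + 2)) = 1 \<Longrightarrow> snd (s (M + 3)) = 1 \<Longrightarrow> thesis"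
      using later[of "M + 2"] by (simp add: numeral_3_eq_3)
    ultimately show thesis
      using twos later[of M] by fastforce
  qed
  then show ?thesis
  proof cases
    case twos
    then show ?thesis
      using ends_in_Oihcconip[OF s, of M "fst (s M)" "fst (s (M + 1))"] M[of M] M[of "M + 1"]
      by (simp add: prod_eq_iff)
  next
    case (ones n)
    then show ?thesis
      using ends_in_cycle[OF s, of n "fst (s n)" "fst (s (n + 1))"] M[of n] M[of "n + 1"]
      by (simp add: prod_eq_iff)
  qed
qed

theorem theorem26:
  fixes r :: "nat \<Rightarrow> nat list"
  assumes "reverse_sorted_Fibs r"
    and "reverse_sorted (r 0)" and "reverse_sorted (r 1)"
    and "\<not> (r 0 = [] \<and> r 1 = [])"
  shows "(\<exists>k>1. \<exists>N. \<forall>i.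
            r (N + 3 * i) = twos_ones k 1 \<and>
            r (N + 3 * i + 1) = twos_ones k 1 \<and>
            r (N + 3 * i + 2) = twos_ones k 2) \<or>
         (\<exists>k>1. \<exists>N. \<forall>i.
            r (N + 2 * i) = twos_ones (k + i) 2 \<and>
            r (N + 2 * i + 1) = twos_ones (k + i) 2)"
proof -
  define counts where "counts xs = (count_list xs (2::nat), count_list xs 1)" for xs
  define s where "s = counts \<circ> r"
  have counts: "counts (twos_ones a b) = (a, b)" for a b
    by (simp add: counts_def twos_ones_def count_list_replicate)
  have step: "r (n + 2) = reverse_sort (add32 (r n) (r (n + 1)))" for n
    using assms(1) by (auto simp: reverse_sorted_Fibs_def dest: spec[of _ "n + 1"])
  have r: "r n = case_prod twos_ones (s n) \<and> r (n + 1) = case_prod twos_ones (s (n + 1))" for n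
  proof (induction n)
    case 0
    then show ?case
      using assms(2,3) by (auto simp: reverse_sorted_def s_def counts)
  next
    case (Suc n)
    then have "r (n + 2) = case_prod twos_ones (sum_counts (s n) (s (n + 1)))"
      by (simp only: step reverse_sort_add32_twos_ones)
    then have "r (n + 2) = case_prod twos_ones (s (n + 2))"
      by (simp add: s_def counts case_prod_unfold)
    with Suc show ?case by simp
  qed
  have "fibs_counts s"
    unfolding fibs_counts_def
  proof
    fix n
    have "r (n + 2) = case_prod twos_ones (sum_counts (s n) (s (n + 1)))"
      using r[of n] by (simp only: step reverse_sort_add32_twos_ones)
    then show "s (n + 2) = sum_counts (s n) (s (n + 1))"
      by (simp add: s_def counts case_prod_unfold)
  qed
  moreover have "\<not> (s 0 = (0, 0) \<and> s 1 = (0, 0))"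
    using r[of 0] assms(4) by (auto simp: twos_ones_def)
  ultimately have "(\<exists>k>1. \<exists>N. \<forall>i. s (N + 3 * i) = (k, 1) \<and> s (N + 3 * i + 1) = (k, 1) \<and> s (N + 3 * i + 2) = (k, 2)) \<or>
    (\<exists>k>1. \<exists>N. \<forall>i. s (N + 2 * i) = (k + i, 2) \<and> s (N + 2 * i + 1) = (k + i, 2))"
    by (rule fibs_counts_ending)
  moreover have "s n = (a, b) \<longleftrightarrow> r n = twos_ones a b" for n a b
    using r[of n] counts[of a b] by (auto simp: s_def)
  ultimately show ?thesis
    by (simp only:)
qed

end
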